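(* Let $L$ be an environment and $T_0,T_1,T_2$ terms. If $L\vdash T_0\to^{*0}T_1$ and $L\vdash T_0\to^{*0}T_2$, then there exists a term $T$ such that $L\vdash T_1\to^{*0}T$ and $L\vdash T_2\to^{*0}T$.
   Context: Fix a nonempty set $\Sigma$ of sorts with decidable equality, an arbitrary function $\mathrm{next}:\Sigma\to\Sigma$, and a countably infinite set of variables. Terms and environments are given by the grammars $T,U,V,W ::= \star s \mid x \mid \mathrm{app}(V,T) \mid \lambda x{:}W.\,T \mid \mathrm{def}(x{=}V).\,T \mid \mathrm{cast}(U,T)$ (with $s\in\Sigma$, $x$ a variable) and $L,K ::= \emptyset \mid K,x{:}W \mid K,x{=}V$. Here $\mathrm{app}(V,T)$ is the application of the function $T$ to the argument $V$; $\lambda x{:}W.\,T$ is de Bruijn's abstraction, binding $x$ in $T$, with expected type $W$; $\mathrm{def}(x{=}V).\,T$ is a local definition (explicit substitution) of $x$ as $V$ in $T$, binding $x$ in $T$; $\mathrm{cast}(U,T)$ annotates $T$ with its expected type $U$. In environments the entry $x{:}W$ declares $x$ with expected type $W$ and $x{=}V$ defines $x$ as $V$; entries bind the free variables of terms considered in that environment. Terms are taken modulo renaming of bound variables, and bound variables are assumed distinct from each other and from free variables. Write $\mathsf{B}x[V]$ for either binder $\lambda x{:}V$ or $\mathrm{def}(x{=}V)$, and correspondingly $L,x[V]$ for $L,x{:}V$ resp. $L,x{=}V$ (same kind in every occurrence within a rule). One step of bound rt-reduction $L\vdash T_1\to^{n}T_2$ is the smallest relation closed under: ($\beta$) $L\vdash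 \mathrm{app}(V,\lambda x{:}W.\,T)\to^0\mathrm{def}(x{=}\mathrm{cast}(W,V)).\,T$; ($\delta$) $K,x{=}V\vdash x\to^0 V$; ($\zeta$) $L\vdash \mathrm{def}(x{=}V).\,T\to^0 T$ if $x$ is not free in $T$; ($\theta$) $L\vdash\mathrm{app}(V,\mathrm{def}(x{=}W).\,T)\to^0\mathrm{def}(x{=}W).\,\mathrm{app}(V,T)$; ($\epsilon$) $L\vdash\mathrm{cast}(U,T)\to^0T$; (s) $L\vdash\star s\to^1\star\,\mathrm{next}(s)$; (l) $K,x{:}W\vdash x\to^1 W$; (e) $L\vdash\mathrm{cast}(U,T)\to^1U$; if $K\vdash x\to^nT$, $y\neq x$ and $y$ is not free in $T$, then $K,y[V]\vdash x\to^nT$; if $L\vdash V_1\to^0V_2$ then $L\vdash\mathrm{app}(V_1,T)\to^0\mathrm{app}(V_2,T)$; if $L\vdash T_1\to^nT_2$ then $L\vdash\mathrm{app}(V,T_1)\to^n\mathrm{app}(V,T_2)$; if $L\vdash V_1\to^0V_2$ then $L\vdash\mathsf{B}x[V_1].\,T\to^0\mathsf{B}x[V_2].\,T$; if $L,x[V]\vdash T_1\to^nT_2$ then $L\vdash\mathsf{B}x[V].\,T_1\to^n\mathsf{B}x[V].\,T_2$; if $L\vdash U_1\to^0U_2$ then $L\vdash\mathrm{cast}(U_1,T)\to^0\mathrm{cast}(U_2,T)$; if $L\vdash T_1\to^0T_2$ then $L\vdash\mathrm{cast}(U,T_1)\to^0\mathrm{cast}(U,T_2)$; if $L\vdash U_1\to^1U_2$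 and $L\vdash T_1\to^1T_2$ then $L\vdash\mathrm{cast}(U_1,T_1)\to^1\mathrm{cast}(U_2,T_2)$. The relation $L\vdash T_1\to^{*n}T_2$ ($n\in\mathbb N$) is the smallest relation such that $L\vdash T\to^{*0}T$; $L\vdash T_1\to^nT_2$ implies $L\vdash T_1\to^{*n}T_2$; and $L\vdash T_1\to^{*n_1}T$, $L\vdash T\to^{*n_2}T_2$ imply $L\vdash T_1\to^{*n_1+n_2}T_2$. The relation $\to^{*0}$ is called r-reduction. *)

theory Defs
  imports Main
begin

text \<open>
  Terms modulo renaming of bound variables are represented with de Bruijn indices: a variable
  is the number of binders, then of environment entries, between its occurrence and its own
  binder or entry.  Indices pointing beyond the environment are variables free in the
  environment as well.  The set of sorts is the type variable \<open>'s\<close>.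
\<close>

datatype kind = Abst | Abbr

text \<open>
  The argument is the first component of \<open>App\<close>, the expected type the first component of
  \<open>Cast\<close>.  \<open>Bind b V T\<close> binds index 0 in \<open>T\<close> but not in \<open>V\<close>.
\<close>

datatype 's trm =
    Sort 's
  | Var nat
  | App "'s trm" "'s trm"
  | Bind kind "'s trm" "'s trm"
  | Cast "'s trm" "'s trm"

abbreviation Lam :: "'s trm \<Rightarrow> 's trm \<Rightarrow> 's trm" where
  "Lam W T \<equiv> Bind Abst W T"

abbreviation Def :: "'s trm \<Rightarrow> 's trm \<Rightarrow> 's trm" where
  "Def V T \<equiv> Bind Abbr V T"

text \<open>
  The most recent entry is the head of the list and binds index 0; the term in an entry lives
  in the tail following it.
\<close>

type_synonym 's env = "(kind \<times> 's trm) list"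

text \<open>
  \<open>lift k T\<close> makes room for a fresh variable with index \<open>k\<close>.  The terms of the form
  \<open>lift 0 T\<close> are exactly those in which variable 0 is not free, and \<open>T\<close> is then the same
  term considered outside the scope of that variable.
\<close>

primrec lift :: "nat \<Rightarrow> 's trm \<Rightarrow> 's trm" where
  "lift k (Sort s) = Sort s"
| "lift k (Var i) = Var (if i < k then i else Suc i)"
| "lift k (App V T) = App (lift k V) (lift k T)"
| "lift k (Bind b V T) = Bind b (lift k V) (lift (Suc k) T)"
| "lift k (Cast U T) = Cast (lift k U) (lift k T)"

text \<open>
  Side conditions on names become liftings: in \<open>zeta\<close> and \<open>lref\<close> the lifting expresses that
  the variable is not free in the term, in \<open>theta\<close>, \<open>delta\<close> and \<open>ldecl\<close> it accounts for the
  term entering the scope of one more variable.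
\<close>

inductive rt_step ::
  "('s \<Rightarrow> 's) \<Rightarrow> 's env \<Rightarrow> nat \<Rightarrow> 's trm \<Rightarrow> 's trm \<Rightarrow> bool"
  for nxt :: "'s \<Rightarrow> 's"
where
  beta: "rt_step nxt L 0 (App V (Lam W T)) (Def (Cast W V) T)"
| delta: "rt_step nxt ((Abbr, V) # K) 0 (Var 0) (lift 0 V)"
| zeta: "rt_step nxt L 0 (Def V (lift 0 T)) T"
| theta: "rt_step nxt L 0 (App V (Def W T)) (Def W (App (lift 0 V) T))"
| eps: "rt_step nxt L 0 (Cast U T) T"
| sort: "rt_step nxt L 1 (Sort s) (Sort (nxt s))"
| ldecl: "rt_step nxt ((Abst, W) # K) 1 (Var 0) (lift 0 W)"
| ecast: "rt_step nxt L 1 (Cast U T) U"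
| lref: "rt_step nxt K n (Var i) T
    \<Longrightarrow> rt_step nxt ((b, V) # K) n (Var (Suc i)) (lift 0 T)"
| app_arg: "rt_step nxt L 0 V1 V2 \<Longrightarrow> rt_step nxt L 0 (App V1 T) (App V2 T)"
| app_fun: "rt_step nxt L n T1 T2 \<Longrightarrow> rt_step nxt L n (App V T1) (App V T2)"
| bind_arg: "rt_step nxt L 0 V1 V2 \<Longrightarrow> rt_step nxt L 0 (Bind b V1 T) (Bind b V2 T)"
| bind_body: "rt_step nxt ((b, V) # L) n T1 T2
    \<Longrightarrow> rt_step nxt L n (Bind b V T1) (Bind b V T2)"
| cast_type: "rt_step nxt L 0 U1 U2 \<Longrightarrow> rt_step nxt L 0 (Cast U1 T) (Cast U2 T)"
| cast_term: "rt_step nxt L 0 T1 T2 \<Longrightarrow> rt_step nxt L 0 (Cast U T1) (Cast U T2)"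
| cast_both: "rt_step nxt L 1 U1 U2 \<Longrightarrow> rt_step nxt L 1 T1 T2
    \<Longrightarrow> rt_step nxt L 1 (Cast U1 T1) (Cast U2 T2)"

inductive rt_steps ::
  "('s \<Rightarrow> 's) \<Rightarrow> 's env \<Rightarrow> nat \<Rightarrow> 's trm \<Rightarrow> 's trm \<Rightarrow> bool"
  for nxt :: "'s \<Rightarrow> 's" and L :: "'s env"
where
  refl: "rt_steps nxt L 0 T T"
| step: "rt_step nxt L n T1 T2 \<Longrightarrow> rt_steps nxt L n T1 T2"
| trans: "rt_steps nxt L n1 T1 T \<Longrightarrow> rt_steps nxt L n2 T T2
    \<Longrightarrow> rt_steps nxt L (n1 + n2) T1 T2"

end

theory Submission
  imports Defs "HOL-Library.Confluence"
begin

text \<open>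
  The proof interprets r-reduction in plain \<open>\<beta>\<close>-reduction.  Unfolding all local definitions and
  erasing all casts of a term, and then unfolding the definitions of the environment in the
  result, is itself an r-reduction to a term \<open>sb (env_sb L) (flat T)\<close>.  Under this map every
  r-step becomes a sequence of parallel \<open>\<beta>\<close>-steps.  Conversely a
  \<open>\<beta>\<close>-step is an r-reduction in any environment, because the local definition
  created by \<open>\<beta>\<close> can be unfolded at every occurrence and then discarded.  Hence confluence of parallel \<open>\<beta>\<close>-reduction carries over.
\<close>

section \<open>Simultaneous substitution\<close>

definition up_ren :: "(nat \<Rightarrow> nat) \<Rightarrow> nat \<Rightarrow> nat" where
  "up_ren r = case_nat 0 (\<lambda>i. Suc (r i))"

primrec ren :: "(nat \<Rightarrow> nat) \<Rightarrow> 's trm \<Rightarrow> 's trm" where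
  "ren r (Sort s) = Sort s"
| "ren r (Var i) = Var (r i)"
| "ren r (App V T) = App (ren r V) (ren r T)"
| "ren r (Bind b V T) = Bind b (ren r V) (ren (up_ren r) T)"
| "ren r (Cast U T) = Cast (ren r U) (ren r T)"

definition up :: "(nat \<Rightarrow> 's trm) \<Rightarrow> nat \<Rightarrow> 's trm" where
  "up \<sigma> = case_nat (Var 0) (\<lambda>i. ren Suc (\<sigma> i))"

primrec sb :: "(nat \<Rightarrow> 's trm) \<Rightarrow> 's trm \<Rightarrow> 's trm" where
  "sb \<sigma> (Sort s) = Sort s"
| "sb \<sigma> (Var i) = \<sigma> i"
| "sb \<sigma> (App V T) = App (sb \<sigma> V) (sb \<sigma> T)"
| "sb \<sigma> (Bind b V T) = Bind b (sb \<sigma> V) (sb (up \<sigma>) T)"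
| "sb \<sigma> (Cast U T) = Cast (sb \<sigma> U) (sb \<sigma> T)"

abbreviation inst :: "'s trm \<Rightarrow> 's trm \<Rightarrow> 's trm" where
  "inst U \<equiv> sb (case_nat U Var)"

lemma up_simps [simp]:
  "up_ren r 0 = 0" "up_ren r (Suc i) = Suc (r i)"
  "up \<sigma> 0 = Var 0" "up \<sigma> (Suc i) = ren Suc (\<sigma> i)"
  by (simp_all add: up_ren_def up_def)

lemma lift_eq_ren: "lift k T = ren (\<lambda>i. if i < k then i else Suc i) T"
proof (induction T arbitrary: k)
  case (Bind b V T)
  have "(\<lambda>i. if i < Suc k then i else Suc i) = up_ren (\<lambda>i. if i < k then i else Suc i)"
    by (auto simp: up_ren_def split: nat.splits)
  then show ?case by (simp add: Bind)
qed auto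

lemma lift_0: "lift 0 T = ren Suc T"
  by (simp add: lift_eq_ren)

text \<open>Since \<open>up\<close> shifts by \<open>ren Suc\<close>, renamings come first: under a
  binder \<open>ren_sb\<close> needs \<open>ren_ren\<close>, and \<open>sb_sb\<close> needs both
  mixed laws.\<close>

lemma ren_ren: "ren r (ren q T) = ren (\<lambda>i. r (q i)) T"
proof (induction T arbitrary: r q)
  case (Bind b V T)
  have "(\<lambda>i. up_ren r (up_ren q i)) = up_ren (\<lambda>i. r (q i))"
    by (auto simp: up_ren_def split: nat.splits)
  then show ?case by (simp add: Bind)
qed auto

lemma sb_ren: "sb \<sigma> (ren r T) = sb (\<lambda>i. \<sigma> (r i)) T"
proof (induction T arbitrary: r \<sigma>)
  case (Bind b V T)
  have "(\<lambda>i. up \<sigma> (up_ren r i)) = up (\<lambda>i. \<sigma> (r i))"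
    by (auto simp: up_ren_def up_def split: nat.splits)
  then show ?case by (simp add: Bind)
qed auto

lemma ren_sb: "ren r (sb \<sigma> T) = sb (\<lambda>i. ren r (\<sigma> i)) T"
proof (induction T arbitrary: r \<sigma>)
  case (Bind b V T)
  have "(\<lambda>i. ren (up_ren r) (up \<sigma> i)) = up (\<lambda>i. ren r (\<sigma> i))"
    by (auto simp: up_def ren_ren split: nat.splits)
  then show ?case by (simp add: Bind)
qed auto

lemma sb_sb: "sb \<tau> (sb \<sigma> T) = sb (\<lambda>i. sb \<tau> (\<sigma> i)) T"
proof (induction T arbitrary: \<tau> \<sigma>)
  case (Bind b V T)
  have "(\<lambda>i. sb (up \<tau>) (up \<sigma> i)) = up (\<lambda>i. sb \<tau> (\<sigma> i))"
    by (auto simp: up_def sb_ren ren_sb split: nat.splits)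
  then show ?case by (simp add: Bind)
qed auto

lemma sb_Var [simp]: "sb Var T = T"
proof (induction T)
  case (Bind b V T)
  have "up Var = (Var :: nat \<Rightarrow> 'a trm)"
    by (auto simp: up_def split: nat.splits)
  with Bind show ?case by simp
qed auto

lemma sb_case_nat_shift [simp]: "sb (case_nat U \<sigma>) (ren Suc T) = sb \<sigma> T"
  by (simp add: sb_ren)

lemma sb_inst: "sb \<sigma> (inst U T) = sb (case_nat (sb \<sigma> U) \<sigma>) T"
proof -
  have "(\<lambda>i. sb \<sigma> (case_nat U Var i)) = case_nat (sb \<sigma> U) \<sigma>"
    by (auto split: nat.splits)
  then show ?thesis by (simp add: sb_sb)
qed

lemma inst_sb_up: "inst U (sb (up \<sigma>) T) = sb (case_nat U \<sigma>) T"
proof -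
  have "(\<lambda>i. inst U (up \<sigma> i)) = case_nat U \<sigma>"
    by (auto simp: up_def split: nat.splits)
  then show ?thesis by (simp add: sb_sb)
qed

lemma ren_inst: "ren r (inst U T) = inst (ren r U) (ren (up_ren r) T)"
proof -
  have "(\<lambda>i. ren r (case_nat U Var i)) = (\<lambda>i. case_nat (ren r U) Var (up_ren r i))"
    by (auto simp: up_ren_def split: nat.splits)
  then show ?thesis by (simp add: ren_sb sb_ren)
qed


section \<open>Parallel \<open>\<beta>\<close>-reduction\<close>

text \<open>Tait and Martin-Loef's parallel reduction. \<open>Def\<close> and \<open>Cast\<close>
  only get congruence rules, as terms produced by \<open>flat\<close> contain neither. No reduct of
  \<open>W\<close> appears in \<open>beta\<close>, because contraction discards
  \<open>W\<close>.\<close>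

inductive par :: "'s trm \<Rightarrow> 's trm \<Rightarrow> bool" where
  Sort: "par (Sort s) (Sort s)"
| Var: "par (Var i) (Var i)"
| App: "par V V' \<Longrightarrow> par T T' \<Longrightarrow> par (App V T) (App V' T')"
| Bind: "par V V' \<Longrightarrow> par T T' \<Longrightarrow> par (Bind b V T) (Bind b V' T')"
| Cast: "par U U' \<Longrightarrow> par T T' \<Longrightarrow> par (Cast U T) (Cast U' T')"
| beta: "par V V' \<Longrightarrow> par T T' \<Longrightarrow> par (App V (Lam W T)) (inst V' T')"

inductive_cases par_LamE: "par (Lam W T) M"

lemma par_refl [simp]: "par T T"
  by (induction T) (auto intro: par.intros)

lemma par_ren: "par T T' \<Longrightarrow> par (ren r T) (ren r T')"
  by (induction arbitrary: r rule: par.induct) (auto intro: par.intros simp: ren_inst)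

lemma par_up: "(\<And>i. par (\<sigma> i) (\<tau> i)) \<Longrightarrow> par (up \<sigma> i) (up \<tau> i)"
  by (cases i) (auto intro: par_ren)

lemma par_sb:
  assumes "par T T'" and "\<And>i. par (\<sigma> i) (\<tau> i)"
  shows "par (sb \<sigma> T) (sb \<tau> T')"
  using assms
proof (induction arbitrary: \<sigma> \<tau> rule: par.induct)
  case (beta V V' T T' W)
  have "par (App (sb \<sigma> V) (Lam (sb \<sigma> W) (sb (up \<sigma>) T))) (inst (sb \<tau> V') (sb (up \<tau>) T'))"
    by (intro par.beta beta.IH beta.prems par_up)
  then show ?case by (simp add: inst_sb_up sb_inst)
next
  case (Bind V V' T T' b)
  have "par (sb (up \<sigma>) T) (sb (up \<tau>) T')"
    by (intro Bind.IH par_up Bind.prems)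
  with Bind show ?case by (auto intro: par.Bind)
qed (auto intro: par.intros)

text \<open>Takahashi's complete development: all \<beta>-redexes already present in the term are
  contracted at once.\<close>

fun develop :: "'s trm \<Rightarrow> 's trm" where
  "develop (App V (Lam W T)) = inst (develop V) (develop T)"
| "develop (App V T) = App (develop V) (develop T)"
| "develop (Bind b V T) = Bind b (develop V) (develop T)"
| "develop (Cast U T) = Cast (develop U) (develop T)"
| "develop T = T"

lemma par_inst: "par V V' \<Longrightarrow> par T T' \<Longrightarrow> par (inst V T) (inst V' T')"
  by (rule par_sb) (auto split: nat.splits)

text \<open>The triangle property. As \<open>develop T\<close> depends on \<open>T\<close> alone, it
  closes every peak from \<open>T\<close>, which gives the diamond property.\<close>

lemma par_develop: "par T T' \<Longrightarrow> par T' (develop T)"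
proof (induction rule: par.induct)
  case (App V V' T T')
  show ?case
  proof (cases "\<exists>W S. T = Lam W S")
    case True
    then obtain W S where T: "T = Lam W S" by blast
    \<comment> \<open>A reduct of an abstraction is an abstraction, so the redex not contracted by
      this step is still there for \<open>par.beta\<close>.\<close>
    with App.hyps(2) obtain W' S' where T': "T' = Lam W' S'" by (auto elim: par_LamE)
    from App.IH(2) have "par S' (develop S)"
      unfolding T T' by (auto elim: par_LamE)
    with App.IH(1) show ?thesis by (auto simp: T T' intro: par.beta)
  next
    case False
    then have "develop (App V T) = App (develop V) (develop T)"
      by (cases "App V T" rule: develop.cases) auto
    with App.IH show ?thesis by (auto intro: par.App)
  qed
next
  case (beta V V' T T' W)
  then show ?case by (simp add: par_inst)
qed (simp_all add: par.intros)

lemma confluentp_par: "confluentp par"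
  by (rule strong_confluentp_imp_confluentp, rule strong_confluentpI)
    (blast intro: par_develop)

lemma pars_ren: "par\<^sup>*\<^sup>* T T' \<Longrightarrow> par\<^sup>*\<^sup>* (ren r T) (ren r T')"
  by (induction rule: rtranclp_induct) (auto intro: par_ren rtranclp.rtrancl_into_rtrancl)

lemma rtranclp_map2:
  assumes "\<And>x x' y. R x x' \<Longrightarrow> S (f x y) (f x' y)"
    and "\<And>x y y'. Q y y' \<Longrightarrow> S (f x y) (f x y')"
    and "R\<^sup>*\<^sup>* x x'" and "Q\<^sup>*\<^sup>* y y'"
  shows "S\<^sup>*\<^sup>* (f x y) (f x' y')"
proof -
  from assms(4) have "S\<^sup>*\<^sup>* (f x y) (f x y')"
    by induction (auto intro: assms(2) rtranclp.rtrancl_into_rtrancl)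
  also from assms(3) have "S\<^sup>*\<^sup>* (f x y') (f x' y')"
    by induction (auto intro: assms(1) rtranclp.rtrancl_into_rtrancl)
  finally show ?thesis .
qed

lemma pars_App: "par\<^sup>*\<^sup>* V V' \<Longrightarrow> par\<^sup>*\<^sup>* T T' \<Longrightarrow> par\<^sup>*\<^sup>* (App V T) (App V' T')"
  by (rule rtranclp_map2[of par]) (auto intro: par.App)

lemma pars_Bind: "par\<^sup>*\<^sup>* V V' \<Longrightarrow> par\<^sup>*\<^sup>* T T' \<Longrightarrow> par\<^sup>*\<^sup>* (Bind b V T) (Bind b V' T')"
  by (rule rtranclp_map2[of par]) (auto intro: par.Bind)

lemma pars_Cast: "par\<^sup>*\<^sup>* U U' \<Longrightarrow> par\<^sup>*\<^sup>* T T' \<Longrightarrow> par\<^sup>*\<^sup>* (Cast U T) (Cast U' T')"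
  by (rule rtranclp_map2[of par]) (auto intro: par.Cast)

text \<open>Different indices may need different numbers of steps, so the proof goes by induction on
  the term instead of iterating \<open>par_sb\<close>.\<close>

lemma pars_sb_pointwise:
  "(\<And>i. par\<^sup>*\<^sup>* (\<sigma> i) (\<tau> i)) \<Longrightarrow> par\<^sup>*\<^sup>* (sb \<sigma> T) (sb \<tau> T)"
proof (induction T arbitrary: \<sigma> \<tau>)
  case (Bind b V T)
  have "par\<^sup>*\<^sup>* (up \<sigma> i) (up \<tau> i)" for i
    by (cases i) (auto intro: pars_ren Bind.prems)
  then show ?case by (auto intro: pars_Bind Bind)
qed (auto intro: pars_App pars_Cast)


section \<open>Interpretation of r-steps as \<open>\<beta>\<close>-steps\<close>

text \<open>The type of an abstraction is kept: the result must be an r-reduct of the term, and no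
  r-step erases that type while the abstraction is not applied.\<close>

fun flat :: "'s trm \<Rightarrow> 's trm" where
  "flat (Sort s) = Sort s"
| "flat (Var i) = Var i"
| "flat (App V T) = App (flat V) (flat T)"
| "flat (Lam W T) = Lam (flat W) (flat T)"
| "flat (Def V T) = inst (flat V) (flat T)"
| "flat (Cast U T) = flat T"

lemma flat_ren: "flat (ren r T) = ren r (flat T)"
  by (induction T arbitrary: r rule: flat.induct) (auto simp: ren_inst)

text \<open>In the \<open>Abbr\<close> case the outer \<open>ren Suc\<close> keeps the result in the
  scope of the whole environment, although index 0 no longer occurs in it.\<close>

primrec env_sb :: "'s env \<Rightarrow> nat \<Rightarrow> 's trm" where
  "env_sb [] = Var"
| "env_sb (e # K) = (case e of
      (Abst, W) \<Rightarrow> up (env_sb K)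
    | (Abbr, V) \<Rightarrow> (\<lambda>i. ren Suc (case_nat (sb (env_sb K) (flat V)) (env_sb K) i)))"

inductive_cases step_Var_NilE: "rt_step nxt [] 0 (Var i) U"
inductive_cases step_VarE: "rt_step nxt ((b, V) # L) 0 (Var i) U"

text \<open>The invariant under which r-steps at variables become equalities. It leaves \<sigma>
  general because, below a \<open>Def\<close>, the substitution removes the bound index and so is
  not an \<open>env_sb\<close>.\<close>

definition unfolds :: "('s \<Rightarrow> 's) \<Rightarrow> 's env \<Rightarrow> (nat \<Rightarrow> 's trm) \<Rightarrow> bool" where
  "unfolds nxt L \<sigma> \<longleftrightarrow> (\<forall>i U. rt_step nxt L 0 (Var i) U \<longrightarrow> sb \<sigma> (flat U) = \<sigma> i)"

lemma unfolds_Abst: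
  assumes "unfolds nxt L \<sigma>"
  shows "unfolds nxt ((Abst, W) # L) (up \<sigma>)"
  using assms unfolding unfolds_def
  by (auto elim!: step_VarE simp: lift_0 flat_ren sb_ren simp flip: ren_sb)

lemma unfolds_Abbr:
  assumes "unfolds nxt L \<sigma>"
  shows "unfolds nxt ((Abbr, V) # L) (case_nat (sb \<sigma> (flat V)) \<sigma>)"
  using assms unfolding unfolds_def
  by (auto elim!: step_VarE simp: lift_0 flat_ren)

lemma unfolds_ren:
  assumes "unfolds nxt L \<sigma>"
  shows "unfolds nxt L (\<lambda>i. ren r (\<sigma> i))"
  using assms unfolding unfolds_def by (simp flip: ren_sb)

lemma unfolds_env_sb: "unfolds nxt L (env_sb L)"
proof (induction L)
  case Nil
  then show ?case by (auto simp: unfolds_def elim: step_Var_NilE)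
next
  case (Cons e L)
  obtain b V where e: "e = (b, V)" by (cases e)
  show ?case
    using unfolds_Abst[OF Cons, of V] unfolds_ren[OF unfolds_Abbr[OF Cons, of V], of Suc]
    by (cases b) (simp_all add: e)
qed

text \<open>Only \<beta> costs a parallel step. For the other contractions both sides have the same
  image, by \<sigma> in the case of variables and by \<open>flat\<close> otherwise.\<close>

lemma step_imp_pars:
  assumes "rt_step nxt L 0 T T'" and "unfolds nxt L \<sigma>"
  shows "par\<^sup>*\<^sup>* (sb \<sigma> (flat T)) (sb \<sigma> (flat T'))"
  using assms
proof (induction L "0::nat" T T' arbitrary: \<sigma> rule: rt_step.induct)
  case (beta L V W T)
  have "par (App (flat V) (Lam (flat W) (flat T))) (inst (flat V) (flat T))"
    by (intro par.beta par_refl)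
  then show ?case by (auto dest: par_sb[where \<sigma> = \<sigma> and \<tau> = \<sigma>])
next
  case (delta V K)
  then show ?case using rt_step.delta unfolding unfolds_def by fastforce
next
  case (zeta L V T)
  then show ?case by (simp add: lift_0 flat_ren)
next
  case (theta L V W T)
  then show ?case by (simp add: lift_0 flat_ren)
next
  case (lref K i T b V)
  have "sb \<sigma> (flat (lift 0 T)) = \<sigma> (Suc i)"
    using rt_step.lref[OF lref.hyps(1), of b V] lref.prems unfolding unfolds_def by blast
  then show ?case by simp
next
  case (bind_arg L V V' b T)
  then have V: "par\<^sup>*\<^sup>* (sb \<sigma> (flat V)) (sb \<sigma> (flat V'))" by blast
  show ?case
  proof (cases b)
    case Abst
    with V show ?thesis by (auto intro: pars_Bind)
  next
    case Abbr
    \<comment> \<open>\<open>flat\<close> copies the definiens into the body, so its reduction is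
      repeated at every occurrence.\<close>
    with V show ?thesis by (auto simp: sb_inst intro!: pars_sb_pointwise split: nat.splits)
  qed
next
  case (bind_body b V L T T')
  show ?case
  proof (cases b)
    case Abst
    with bind_body show ?thesis by (auto intro: pars_Bind unfolds_Abst)
  next
    case Abbr
    with bind_body show ?thesis by (auto simp: sb_inst intro: unfolds_Abbr)
  qed
qed (auto intro: pars_App)


section \<open>Simulation of unfolding and \<open>\<beta>\<close> by r-reduction\<close>

abbreviation reds :: "('s \<Rightarrow> 's) \<Rightarrow> 's env \<Rightarrow> 's trm \<Rightarrow> 's trm \<Rightarrow> bool" where
  "reds nxt L \<equiv> (rt_step nxt L 0)\<^sup>*\<^sup>*"

text \<open>Indices add up, so a reduction of index 0 has only steps of index 0.\<close>

lemma rt_steps_0_iff: "rt_steps nxt L 0 T T' \<longleftrightarrow> reds nxt L T T'"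
proof
  show "reds nxt L T T'" if "rt_steps nxt L 0 T T'"
    using that by (induction "0::nat" T T' rule: rt_steps.induct) auto
  show "rt_steps nxt L 0 T T'" if "reds nxt L T T'"
    using that
    by induction
      (auto intro: rt_steps.refl dest: rt_steps.trans[OF _ rt_steps.step])
qed

lemma reds_App: "reds nxt L V V' \<Longrightarrow> reds nxt L T T' \<Longrightarrow> reds nxt L (App V T) (App V' T')"
  by (rule rtranclp_map2[of "rt_step nxt L 0"]) (auto intro: rt_step.intros)

lemma reds_Cast: "reds nxt L U U' \<Longrightarrow> reds nxt L T T' \<Longrightarrow> reds nxt L (Cast U T) (Cast U' T')"
  by (rule rtranclp_map2[of "rt_step nxt L 0"]) (auto intro: rt_step.intros)

lemma reds_Bind:
  assumes "reds nxt L V V'" and "reds nxt ((b, V) # L) T T'"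
  shows "reds nxt L (Bind b V T) (Bind b V' T')"
proof -
  \<comment> \<open>The body goes first, while the entry in its environment is still
    \<open>V\<close>.\<close>
  from assms(2) have "reds nxt L (Bind b V T) (Bind b V T')"
    by induction (auto intro: rt_step.bind_body rtranclp.rtrancl_into_rtrancl)
  also from assms(1) have "reds nxt L (Bind b V T') (Bind b V' T')"
    by induction (auto intro: rt_step.bind_arg rtranclp.rtrancl_into_rtrancl)
  finally show ?thesis .
qed

text \<open>Only steps at variables consult the environment, so a condition on these suffices to
  relate \<open>K\<close> and \<open>L\<close>.\<close>

lemma step_ren:
  assumes "rt_step nxt K 0 T T'"
    and "\<And>i U. rt_step nxt K 0 (Var i) U \<Longrightarrow> rt_step nxt L 0 (Var (r i)) (ren r U)"
  shows "rt_step nxt L 0 (ren r T) (ren r T')"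
  using assms
proof (induction K "0::nat" T T' arbitrary: L r rule: rt_step.induct)
  case (delta V K)
  then show ?case using rt_step.delta by fastforce
next
  case (lref K i T b V)
  then show ?case using rt_step.lref[OF lref.hyps(1), of b V] by simp
next
  case (zeta K V T)
  have "rt_step nxt L 0 (Def (ren r V) (lift 0 (ren r T))) (ren r T)"
    by (rule rt_step.zeta)
  then show ?case by (simp add: lift_0 ren_ren)
next
  case (theta K V W T)
  have "rt_step nxt L 0 (App (ren r V) (Def (ren r W) (ren (up_ren r) T)))
    (Def (ren r W) (App (lift 0 (ren r V)) (ren (up_ren r) T)))"
    by (rule rt_step.theta)
  then show ?case by (simp add: lift_0 ren_ren)
next
  case (bind_body b V K T T')
  have "rt_step nxt ((b, ren r V) # L) 0 (Var (up_ren r i)) (ren (up_ren r) U)"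
    if "rt_step nxt ((b, V) # K) 0 (Var i) U" for i U
    using that
  proof (rule step_VarE)
    assume "b = Abbr" "i = 0" "U = lift 0 V"
    then show ?thesis
      using rt_step.delta[of nxt "ren r V" L] by (simp add: lift_0 ren_ren)
  next
    fix j U'
    assume "i = Suc j" "U = lift 0 U'" and "rt_step nxt K 0 (Var j) U'"
    from this(1,2) show ?thesis
      using rt_step.lref[OF bind_body.prems[OF \<open>rt_step nxt K 0 (Var j) U'\<close>], of b "ren r V"]
      by (simp add: lift_0 ren_ren)
  qed
  with bind_body show ?case by (auto intro: rt_step.bind_body)
qed (auto intro: rt_step.intros)

lemma reds_weaken: "reds nxt L T T' \<Longrightarrow> reds nxt (e # L) (ren Suc T) (ren Suc T')"
proof (induction rule: rtranclp_induct)
  case (step T' T'')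
  have "rt_step nxt (e # L) 0 (Var (Suc i)) (ren Suc U)" if "rt_step nxt L 0 (Var i) U" for i U
    using rt_step.lref[OF that] by (cases e) (simp add: lift_0)
  with step show ?case by (auto intro: step_ren rtranclp.rtrancl_into_rtrancl)
qed simp

lemma reds_up:
  assumes "\<And>i. reds nxt L (Var i) (\<sigma> i)"
  shows "reds nxt (e # L) (Var i) (up \<sigma> i)"
  using reds_weaken[OF assms] by (cases i) auto

lemma reds_sb: "(\<And>i. reds nxt L (Var i) (\<sigma> i)) \<Longrightarrow> reds nxt L T (sb \<sigma> T)"
proof (induction T arbitrary: L \<sigma>)
  case (Bind b V T)
  have "reds nxt ((b, V) # L) T (sb (up \<sigma>) T)"
    by (intro Bind.IH reds_up Bind.prems)
  with Bind show ?case by (auto intro: reds_Bind)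
qed (auto intro: reds_App reds_Cast)

text \<open>Used with \<sigma> = \<open>Var\<close> to unfold one definition, and with
  \<open>env_sb\<close> to unfold a whole environment.\<close>

lemma reds_Var_Abbr:
  assumes "reds nxt L V V'" and "\<And>i. reds nxt L (Var i) (\<sigma> i)"
  shows "reds nxt ((Abbr, V) # L) (Var i) (ren Suc (case_nat V' \<sigma> i))"
proof (cases i)
  case 0
  have "rt_step nxt ((Abbr, V) # L) 0 (Var 0) (ren Suc V)"
    using rt_step.delta[of nxt V L] by (simp add: lift_0)
  with reds_weaken[OF assms(1)] 0 show ?thesis by (auto intro: converse_rtranclp_into_rtranclp)
next
  case (Suc j)
  then show ?thesis using reds_weaken[OF assms(2)[of j]] by simp
qed

lemma reds_Def_inst:
  assumes "reds nxt L V V'"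
  shows "reds nxt L (Def V T) (inst V' T)"
proof -
  have "reds nxt ((Abbr, V) # L) T (sb (\<lambda>i. ren Suc (case_nat V' Var i)) T)"
    by (intro reds_sb reds_Var_Abbr assms) simp
  \<comment> \<open>Once all occurrences are unfolded, index 0 is no longer free in the body, which
    has the lifted form that \<open>zeta\<close> requires.\<close>
  then have "reds nxt L (Def V T) (Def V (lift 0 (inst V' T)))"
    by (intro reds_Bind) (simp_all add: lift_0 ren_sb)
  then show ?thesis by (rule rtranclp.rtrancl_into_rtrancl) (rule rt_step.zeta)
qed

lemma reds_flat: "reds nxt L T (flat T)"
proof (induction T arbitrary: L rule: flat.induct)
  case (5 V T)
  have "reds nxt L (Def V T) (Def V (flat T))"
    by (intro reds_Bind 5) simp
  also have "reds nxt L \<dots> (inst (flat V) (flat T))"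
    by (intro reds_Def_inst 5)
  finally show ?case by simp
next
  case (6 U T)
  then show ?case by (auto intro: rt_step.eps converse_rtranclp_into_rtranclp)
qed (auto intro: reds_App reds_Bind)

lemma reds_env_sb: "reds nxt L (Var i) (env_sb L i)"
proof (induction L arbitrary: i)
  case (Cons e L)
  obtain b V where e: "e = (b, V)" by (cases e)
  have "reds nxt L V (sb (env_sb L) (flat V))"
    using reds_flat reds_sb[OF Cons] by (rule rtranclp_trans)
  from reds_up[OF Cons, of e] reds_Var_Abbr[OF this Cons] show ?case
    by (cases b) (simp_all add: e)
qed simp

lemma par_imp_reds: "par T T' \<Longrightarrow> reds nxt L T T'"
proof (induction arbitrary: L rule: par.induct)
  case (beta V V' T T' W)
  have "reds nxt L (App V (Lam W T)) (App V (Lam W T'))"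
    by (intro reds_App reds_Bind beta.IH) simp_all
  also have "rt_step nxt L 0 \<dots> (Def (Cast W V) T')"
    by (rule rt_step.beta)
  \<comment> \<open>The definiens \<open>Cast W V\<close> reaches \<open>V'\<close> by
    \<open>eps\<close> and the induction hypothesis, so its unfolded copies lose the cast.\<close>
  also have "reds nxt L \<dots> (inst V' T')"
    using beta.IH(1) by (auto intro!: reds_Def_inst intro: rt_step.eps converse_rtranclp_into_rtranclp)
  finally show ?case .
qed (auto intro: reds_App reds_Bind reds_Cast)

lemma pars_imp_reds: "par\<^sup>*\<^sup>* T T' \<Longrightarrow> reds nxt L T T'"
  by (induction rule: rtranclp_induct) (simp, erule rtranclp_trans, erule par_imp_reds)

lemma reds_imp_pars:
  "reds nxt L T T' \<Longrightarrow> par\<^sup>*\<^sup>* (sb (env_sb L) (flat T)) (sb (env_sb L) (flat T'))"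
  by (induction rule: rtranclp_induct)
    (simp, erule rtranclp_trans, erule step_imp_pars, rule unfolds_env_sb)

lemma reds_env_flat: "reds nxt L T (sb (env_sb L) (flat T))"
  using reds_flat reds_sb[OF reds_env_sb] by (rule rtranclp_trans)

theorem theorem3p2:
  fixes nxt :: "'s \<Rightarrow> 's"
    and L :: "'s env"
    and T0 T1 T2 :: "'s trm"
  assumes "rt_steps nxt L 0 T0 T1"
    and "rt_steps nxt L 0 T0 T2"
  shows "\<exists>T. rt_steps nxt L 0 T1 T \<and> rt_steps nxt L 0 T2 T"
proof -
  from assms have "reds nxt L T0 T1" "reds nxt L T0 T2"
    by (simp_all add: rt_steps_0_iff)
  then obtain T where
    "par\<^sup>*\<^sup>* (sb (env_sb L) (flat T1)) T" "par\<^sup>*\<^sup>* (sb (env_sb L) (flat T2)) T"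
    using confluentpD[OF confluentp_par] reds_imp_pars by metis
  \<comment> \<open>Each side first r-reduces to its interpretation; the parallel steps from there
    to \<open>T\<close> are then r-reductions in \<open>L\<close>.\<close>
  then have "reds nxt L T1 T" "reds nxt L T2 T"
    by (blast intro: rtranclp_trans[OF reds_env_flat pars_imp_reds])+
  then show ?thesis by (auto simp: rt_steps_0_iff)
qed

end
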